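(* Let $S$ be a $\mathrm{Cu}$-semigroup satisfying (O5), (O6), (O7) and (O8). Then $S$ is $(2,\omega)$-divisible if and only if $S$ is weakly $(2,\omega)$-divisible, ideal-filtered, and has property (V).
   Context: A positively ordered monoid is a commutative monoid $S$ (written additively) with a partial order $\leq$ such that $0\leq x$ for all $x$, and $x\leq y$ implies $x+z\leq y+z$. In a partially ordered set in which every increasing sequence has a supremum, $x\ll y$ ($x$ is way-below $y$) means: for every increasing sequence $(z_n)_n$ with $y\leq\sup_n z_n$ there is $m$ with $x\leq z_m$. A $\mathrm{Cu}$-semigroup is a positively ordered monoid $S$ satisfying: (O1) every increasing sequence has a supremum; (O2) every element is the supremum of a $\ll$-increasing sequence; (O3) if $x'\ll x$ and $y'\ll y$, then $x'+y'\ll x+y$; (O4) $\sup_n(x_n+y_n)=\sup_n x_n+\sup_n y_n$ for all increasing sequences $(x_n)_n,(y_n)_n$. Write $\infty x:=\sup_n nx$. An expression such as $u\ll x,y$ means $u\ll x$ and $u\ll y$ (similarly for $\leq$ and for lists on the left). Further axioms: (O5) Given $x'\ll x$, $y'\ll y$ and $x+y\leq z$, there exists $c$ such that $y'\ll c$ and $x'+c\leq z\leq x+c$. (O6) Given $x'\ll x\leq y+z$, there exist $v,w$ such that $v\ll x,y$ and $w\ll x,z$ and $x'\ll v+w$. (O7) Given $x_1'\ll x_1\ll w$ and $x_2'\ll x_2\ll w$, there exists $x\in S$ such that $x_1',x_2'\ll x\ll w,\,x_1+x_2$. (O8) Given $x'\ll x$, $y'\ll y$, $w=2w$ and $z$ in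 $S$ such that $x+y\ll z+w$, there exist $z_1,z_2\in S$ with $z_1+z_2\ll z$, $x'\ll z_1+w$, $y'\ll z_2+w$, $z_1\ll x+w$ and $z_2\ll y+w$. $S$ is $(2,\omega)$-divisible if for all $x'\ll x$ in $S$ there exists $z\in S$ with $2z\ll x$ and $x'\ll\infty z$. $S$ is weakly $(2,\omega)$-divisible if for all $x'\ll x$ in $S$ there exist finitely many $z_1,\ldots,z_n\in S$ with $2z_j\ll x$ for every $j$ and $x'\ll z_1+\ldots+z_n$. $S$ is ideal-filtered if for all $v',v,x,y\in S$ with $v'\ll v\ll\infty x,\infty y$ there exists $z\in S$ with $v'\ll\infty z$ and $z\ll x,y$. $S$ has property (V) if for all $c,d_1',d_1,d_2',d_2,x\in S$ satisfying $d_j'\ll d_j$ for $j=1,2$, $d_1,d_2\ll c$, and $c+d_1,c+d_2\ll x$, there exist $y,z\in S$ such that $y+z\leq x$ and $d_1'+d_2'\leq\infty y,\infty z$. *)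

theory Defs
  imports Complex_Main "HOL-Library.Lub_Glb"
begin

text \<open>
  Suprema of increasing sequences are expressed by the relation
  \<open>isLub UNIV (range z) s\<close>, since the order need not have any other suprema.
\<close>

class pos_ordered_monoid = ordered_comm_monoid_add +
  assumes zero_least: "0 \<le> x"

definition way_below :: "'a::order \<Rightarrow> 'a \<Rightarrow> bool"  (infix \<open>\<lless>\<close> 50) where
  "x \<lless> y \<longleftrightarrow>
     (\<forall>z s. incseq z \<longrightarrow> isLub UNIV (range z) s \<longrightarrow> y \<le> s \<longrightarrow> (\<exists>m::nat. x \<le> z m))"

definition O1 :: "'a::pos_ordered_monoid itself \<Rightarrow> bool" where
  "O1 _ \<longleftrightarrow> (\<forall>x::nat \<Rightarrow> 'a. incseq x \<longrightarrow> (\<exists>s. isLub UNIV (range x) s))"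

definition O2 :: "'a::pos_ordered_monoid itself \<Rightarrow> bool" where
  "O2 _ \<longleftrightarrow>
     (\<forall>x::'a. \<exists>z::nat \<Rightarrow> 'a. (\<forall>n. z n \<lless> z (Suc n)) \<and> isLub UNIV (range z) x)"

definition O3 :: "'a::pos_ordered_monoid itself \<Rightarrow> bool" where
  "O3 _ \<longleftrightarrow> (\<forall>x' x y' y::'a. x' \<lless> x \<longrightarrow> y' \<lless> y \<longrightarrow> x' + y' \<lless> x + y)"

definition O4 :: "'a::pos_ordered_monoid itself \<Rightarrow> bool" where
  "O4 _ \<longleftrightarrow>
     (\<forall>(x::nat \<Rightarrow> 'a) y s t. incseq x \<longrightarrow> incseq y \<longrightarrow>
        isLub UNIV (range x) s \<longrightarrow> isLub UNIV (range y) t \<longrightarrow>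
        isLub UNIV (range (\<lambda>n. x n + y n)) (s + t))"

definition Cu_semigroup :: "'a::pos_ordered_monoid itself \<Rightarrow> bool" where
  "Cu_semigroup T \<longleftrightarrow> O1 T \<and> O2 T \<and> O3 T \<and> O4 T"

text \<open>
  The sum below is the multiple \<open>n x\<close>. The description is meaningful under \<open>O1\<close>,
  as the following lemma records.
\<close>

definition infty_mult :: "'a::pos_ordered_monoid \<Rightarrow> 'a" where
  "infty_mult x = (THE s. isLub UNIV (range (\<lambda>n::nat. \<Sum>i<n. x)) s)"

lemma infty_mult_isLub:
  fixes x :: "'a::pos_ordered_monoid"
  assumes "O1 TYPE('a)"
  shows "isLub UNIV (range (\<lambda>n::nat. \<Sum>i<n. x)) (infty_mult x)"
proof -
  have "(\<Sum>i<n. x) \<le> (\<Sum>i<Suc n. x)" for n :: nat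
    using add_left_mono[OF zero_least[of x], of "\<Sum>i<n. x"] by (simp add: add.commute)
  then have "incseq (\<lambda>n::nat. \<Sum>i<n. x)"
    by (rule incseq_SucI)
  then obtain s where s: "isLub UNIV (range (\<lambda>n::nat. \<Sum>i<n. x)) s"
    using assms unfolding O1_def by blast
  have "t = s" if "isLub UNIV (range (\<lambda>n::nat. \<Sum>i<n. x)) t" for t
    using that s by (meson antisym isLub_isUb isLub_le_isUb)
  with s show ?thesis
    unfolding infty_mult_def by (rule theI)
qed

definition O5 :: "'a::pos_ordered_monoid itself \<Rightarrow> bool" where
  "O5 _ \<longleftrightarrow>
     (\<forall>x' x y' y z::'a. x' \<lless> x \<longrightarrow> y' \<lless> y \<longrightarrow> x + y \<le> z \<longrightarrow>
        (\<exists>c. y' \<lless> c \<and> x' + c \<le> z \<and> z \<le> x + c))"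

definition O6 :: "'a::pos_ordered_monoid itself \<Rightarrow> bool" where
  "O6 _ \<longleftrightarrow>
     (\<forall>x' x y z::'a. x' \<lless> x \<longrightarrow> x \<le> y + z \<longrightarrow>
        (\<exists>v w. v \<lless> x \<and> v \<lless> y \<and> w \<lless> x \<and> w \<lless> z \<and> x' \<lless> v + w))"

definition O7 :: "'a::pos_ordered_monoid itself \<Rightarrow> bool" where
  "O7 _ \<longleftrightarrow>
     (\<forall>x1' x1 x2' x2 w::'a. x1' \<lless> x1 \<longrightarrow> x1 \<lless> w \<longrightarrow> x2' \<lless> x2 \<longrightarrow> x2 \<lless> w \<longrightarrow>
        (\<exists>x. x1' \<lless> x \<and> x2' \<lless> x \<and> x \<lless> w \<and> x \<lless> x1 + x2))"

definition O8 :: "'a::pos_ordered_monoid itself \<Rightarrow> bool" where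
  "O8 _ \<longleftrightarrow>
     (\<forall>x' x y' y w z::'a. x' \<lless> x \<longrightarrow> y' \<lless> y \<longrightarrow> w = w + w \<longrightarrow> x + y \<lless> z + w \<longrightarrow>
        (\<exists>z1 z2. z1 + z2 \<lless> z \<and> x' \<lless> z1 + w \<and> y' \<lless> z2 + w \<and>
           z1 \<lless> x + w \<and> z2 \<lless> y + w))"

definition two_omega_divisible :: "'a::pos_ordered_monoid itself \<Rightarrow> bool" where
  "two_omega_divisible _ \<longleftrightarrow>
     (\<forall>x' x::'a. x' \<lless> x \<longrightarrow> (\<exists>z. z + z \<lless> x \<and> x' \<lless> infty_mult z))"

definition weakly_two_omega_divisible :: "'a::pos_ordered_monoid itself \<Rightarrow> bool" where
  "weakly_two_omega_divisible _ \<longleftrightarrow>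
     (\<forall>x' x::'a. x' \<lless> x \<longrightarrow>
        (\<exists>(n::nat) z. (\<forall>j\<in>{1..n}. z j + z j \<lless> x) \<and> x' \<lless> (\<Sum>j=1..n. z j)))"

definition ideal_filtered :: "'a::pos_ordered_monoid itself \<Rightarrow> bool" where
  "ideal_filtered _ \<longleftrightarrow>
     (\<forall>v' v x y::'a. v' \<lless> v \<longrightarrow> v \<lless> infty_mult x \<longrightarrow> v \<lless> infty_mult y \<longrightarrow>
        (\<exists>z. v' \<lless> infty_mult z \<and> z \<lless> x \<and> z \<lless> y))"

definition property_V :: "'a::pos_ordered_monoid itself \<Rightarrow> bool" where
  "property_V _ \<longleftrightarrow>
     (\<forall>c d1' d1 d2' d2 x::'a.
        d1' \<lless> d1 \<longrightarrow> d2' \<lless> d2 \<longrightarrow> d1 \<lless> c \<longrightarrow> d2 \<lless> c \<longrightarrow> c + d1 \<lless> x \<longrightarrow> c + d2 \<lless> x \<longrightarrow>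
        (\<exists>y z. y + z \<le> x \<and> d1' + d2' \<le> infty_mult y \<and> d1' + d2' \<le> infty_mult z))"

end

theory Submission
  imports Defs
begin

text \<open>
  For the backward direction it suffices to merge two elements \<open>a\<close>, \<open>b\<close> with \<open>2a, 2b \<lless> x\<close>
  into one \<open>e\<close> with \<open>2e \<lless> x\<close> that generates both (up to \<open>\<lless>\<close>). Since \<open>2a \<le> x\<close>, the
  complement of \<open>a\<close> in \<open>x\<close> given by (O5) generates the same ideal as \<open>x\<close>, and likewise for \<open>b\<close>;
  filteredness yields one full element \<open>s\<close> below both complements and then full parts of \<open>a\<close> and
  \<open>b\<close> below \<open>s\<close>. Now (V) applies with \<open>c = s\<close>, and filteredness turns its two summands into \<open>2e\<close>.

  For ideal-filteredness of divisible semigroups, (O6) and (O7) show that an element \<open>u \<le> n y\<close> has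
  the same ideal, up to \<open>\<lless>\<close>, as some \<open>z \<lless> y\<close> with \<open>z \<le> n u\<close>. Applying this first to find a
  full \<open>w \<lless> x\<close> with \<open>w \<le> n y\<close>, and then to \<open>u\<close> with \<open>n u \<lless> w\<close>, gives \<open>z \<lless> x, y\<close>.
\<close>

section \<open>The way-below relation in a partial order\<close>

lemma isLub_range_iff:
  fixes z :: "nat \<Rightarrow> 'a::order"
  shows "isLub UNIV (range z) s \<longleftrightarrow> (\<forall>n. z n \<le> s) \<and> (\<forall>t. (\<forall>n. z n \<le> t) \<longrightarrow> s \<le> t)"
  by (auto simp: isLub_def leastP_def isUb_def setle_def setge_def)

text \<open>The constant sequence at \<open>y\<close> is a test sequence for the definition.\<close>

lemma way_below_imp_le:
  fixes x y :: "'a::order"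
  assumes "x \<lless> y"
  shows "x \<le> y"
proof -
  have "isLub UNIV (range (\<lambda>n::nat. y)) y" "incseq (\<lambda>n::nat. y)"
    by (simp_all only: isLub_range_iff incseq_def) auto
  then show ?thesis
    using assms unfolding way_below_def by blast
qed

lemma le_way_below_trans:
  fixes x y z :: "'a::order"
  shows "x \<le> y \<Longrightarrow> y \<lless> z \<Longrightarrow> x \<lless> z"
  unfolding way_below_def by (meson order_trans)

lemma way_below_le_trans:
  fixes x y z :: "'a::order"
  shows "x \<lless> y \<Longrightarrow> y \<le> z \<Longrightarrow> x \<lless> z"
  unfolding way_below_def by (meson order_trans)

lemma way_below_trans:
  fixes x y z :: "'a::order"
  shows "x \<lless> y \<Longrightarrow> y \<lless> z \<Longrightarrow> x \<lless> z"
  using le_way_below_trans way_below_imp_le by blast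

lemma zero_way_below: "(0::'a::pos_ordered_monoid) \<lless> x"
  by (simp add: way_below_def zero_least)

lemma le_add_left: "(x::'a::pos_ordered_monoid) \<le> x + y"
  using add_left_mono[OF zero_least[of y], of x] by simp

lemma le_add_right: "(x::'a::pos_ordered_monoid) \<le> y + x"
  using le_add_left[of x y] by (simp add: add.commute)

section \<open>Approximation and sums in a Cu-semigroup\<close>

context
  assumes Cu: "Cu_semigroup TYPE('a::pos_ordered_monoid)"
begin

lemma ex_way_below_sequence:
  obtains z where "\<And>n. z n \<lless> z (Suc n)" "incseq z" "isLub UNIV (range z) (x::'a)"
proof -
  obtain z where z: "\<And>n. z n \<lless> z (Suc n)" "isLub UNIV (range z) x"
    using Cu unfolding Cu_semigroup_def O2_def by blast
  moreover have "incseq z"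
    using z(1) way_below_imp_le by (blast intro: incseq_SucI)
  ultimately show ?thesis
    using that by blast
qed

text \<open>By (O2), one \<open>\<lless>\<close>-increasing sequence approximates \<open>x\<close>,
  and a late enough term dominates both elements. The next term is kept too, because filteredness is
  stated for a pair \<open>v' \<lless> v\<close>.\<close>

lemma way_below_directed:
  fixes a b x :: 'a
  assumes "a \<lless> x" "b \<lless> x"
  obtains v' v where "a \<le> v'" "b \<le> v'" "v' \<lless> v" "v \<lless> x"
proof -
  obtain z where z: "\<And>n. z n \<lless> z (Suc n)" "incseq z" "isLub UNIV (range z) x"
    using ex_way_below_sequence by blast
  obtain m n where "a \<le> z m" "b \<le> z n"
    using assms z unfolding way_below_def by blast
  then have "a \<le> z (max m n)" "b \<le> z (max m n)"
    using z(2) by (meson incseq_def max.cobounded1 max.cobounded2 order_trans)+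
  moreover have "z (Suc (max m n)) \<lless> x"
    using z(1,3) unfolding isLub_range_iff by (meson way_below_le_trans)
  ultimately show ?thesis
    using that z(1) by blast
qed

lemma way_below_interpolate:
  fixes a x :: 'a
  assumes "a \<lless> x"
  obtains v where "a \<lless> v" "v \<lless> x"
  using way_below_directed[OF assms assms] le_way_below_trans by metis

lemma way_below_add:
  fixes x' x y' y :: 'a
  shows "x' \<lless> x \<Longrightarrow> y' \<lless> y \<Longrightarrow> x' + y' \<lless> x + y"
  using Cu unfolding Cu_semigroup_def O3_def by blast

lemma way_below_addE:
  fixes u x y :: 'a
  assumes "u \<lless> x + y"
  obtains x' y' where "x' \<lless> x" "y' \<lless> y" "u \<lless> x' + y'"
proof -
  \<comment> \<open>The supremum given by (O4) yields only \<open>\<le>\<close> at some index;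
    applying it to \<open>u1\<close> leaves room for \<open>\<lless>\<close> at
    \<open>u\<close>.\<close>
  obtain u1 where u1: "u \<lless> u1" "u1 \<lless> x + y"
    using way_below_interpolate[OF assms] .
  obtain s where s: "\<And>n. s n \<lless> s (Suc n)" "incseq s" "isLub UNIV (range s) x"
    using ex_way_below_sequence by blast
  obtain t where t: "\<And>n. t n \<lless> t (Suc n)" "incseq t" "isLub UNIV (range t) y"
    using ex_way_below_sequence by blast
  have "isLub UNIV (range (\<lambda>n. s n + t n)) (x + y)"
    using Cu s t unfolding Cu_semigroup_def O4_def by blast
  moreover have "incseq (\<lambda>n. s n + t n)"
    using s(2) t(2) by (simp add: incseq_def add_mono)
  ultimately obtain m where "u1 \<le> s m + t m"
    using u1(2) unfolding way_below_def by blast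
  then have "u \<lless> s m + t m"
    using u1(1) way_below_le_trans by blast
  moreover have "s m \<lless> x" "t m \<lless> y"
    using s(1,3) t(1,3) unfolding isLub_range_iff by (meson way_below_le_trans)+
  ultimately show ?thesis
    using that by blast
qed

section \<open>The ideal generated by an element\<close>

lemma infty_mult_Lub: "isLub UNIV (range (\<lambda>n::nat. \<Sum>i<n. x)) (infty_mult (x::'a))"
  using Cu infty_mult_isLub unfolding Cu_semigroup_def by blast

lemma incseq_multiples: "incseq (\<lambda>n::nat. \<Sum>i<n. (x::'a))"
  by (rule incseq_SucI) (simp add: le_add_left)

lemma multiple_le_infty_mult: "(\<Sum>i<(n::nat). x) \<le> infty_mult (x::'a)"
  using infty_mult_Lub unfolding isLub_range_iff by blast

lemma le_infty_mult: "x \<le> infty_mult (x::'a)"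
  using multiple_le_infty_mult[of x 1] by simp

text \<open>Doubling the \<open>n\<close>-th multiple gives the \<open>2n\<close>-th, so the
  supremum computed by (O4) stays below \<open>infty_mult x\<close>. Hence the elements below
  \<open>infty_mult x\<close> are closed under addition.\<close>

lemma infty_mult_add_self: "infty_mult x + infty_mult x = infty_mult (x::'a)"
proof (rule antisym)
  have "(\<Sum>i<n. x) + (\<Sum>i<n. x) = (\<Sum>i<n + n. x)" for n :: nat
    by (induction n) (simp_all add: ac_simps)
  then have "(\<Sum>i<n. x) + (\<Sum>i<n. x) \<le> infty_mult x" for n :: nat
    by (simp only: multiple_le_infty_mult)
  moreover have "isLub UNIV (range (\<lambda>n::nat. (\<Sum>i<n. x) + (\<Sum>i<n. x))) (infty_mult x + infty_mult x)"
    using Cu infty_mult_Lub[of x] incseq_multiples[of x]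
    unfolding Cu_semigroup_def O4_def by blast
  ultimately show "infty_mult x + infty_mult x \<le> infty_mult x"
    unfolding isLub_range_iff by blast
qed (rule le_add_left)

lemma add_le_infty_mult:
  fixes a b x :: 'a
  assumes "a \<le> infty_mult x" "b \<le> infty_mult x"
  shows "a + b \<le> infty_mult x"
  using add_mono[OF assms] by (simp add: infty_mult_add_self)

lemma multiple_le_infty_multI:
  fixes a x :: 'a
  assumes "a \<le> infty_mult x"
  shows "(\<Sum>i<(n::nat). a) \<le> infty_mult x"
  using assms by (induction n) (simp_all add: zero_least add_le_infty_mult)

lemma infty_mult_leI:
  fixes a x :: 'a
  assumes "a \<le> infty_mult x"
  shows "infty_mult a \<le> infty_mult x"
  using infty_mult_Lub[of a] multiple_le_infty_multI[OF assms]
  unfolding isLub_range_iff by blast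

lemma way_below_infty_mult_trans:
  fixes u a x :: 'a
  assumes "u \<lless> infty_mult a" "a \<le> infty_mult x"
  shows "u \<lless> infty_mult x"
  using assms infty_mult_leI way_below_le_trans by blast

lemma way_below_infty_multE:
  fixes u x :: 'a
  assumes "u \<lless> infty_mult x"
  obtains n :: nat where "u \<lless> (\<Sum>i<n. x)"
proof -
  obtain u1 where u1: "u \<lless> u1" "u1 \<lless> infty_mult x"
    using way_below_interpolate[OF assms] .
  then obtain n :: nat where "u1 \<le> (\<Sum>i<n. x)"
    using infty_mult_Lub incseq_multiples unfolding way_below_def by blast
  then show ?thesis
    using that u1(1) way_below_le_trans by blast
qed

text \<open>Each summand may need its own approximation of \<open>x\<close>, but directedness puts
  one element above all of them. This lets later arguments pass to a strictly smaller
  generator.\<close>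

lemma way_below_multiple_shrink:
  fixes u x :: 'a
  assumes "u \<lless> (\<Sum>i<(n::nat). x)"
  shows "\<exists>x'. x' \<lless> x \<and> u \<lless> infty_mult x'"
  using assms
proof (induction n arbitrary: u)
  case 0
  then have "u \<lless> 0"
    by simp
  then show ?case
    using zero_way_below zero_least way_below_le_trans by blast
next
  case (Suc n)
  then have "u \<lless> (\<Sum>i<n. x) + x"
    by simp
  then obtain s t where st: "s \<lless> (\<Sum>i<n. x)" "t \<lless> x" "u \<lless> s + t"
    by (rule way_below_addE)
  then obtain x1 where x1: "x1 \<lless> x" "s \<lless> infty_mult x1"
    using Suc.IH by blast
  obtain v' v where v: "x1 \<le> v'" "t \<le> v'" "v' \<lless> v" "v \<lless> x"
    using way_below_directed x1(1) st(2) by blast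
  have "s \<le> infty_mult v'"
    by (meson le_infty_mult order_trans v(1) way_below_imp_le way_below_infty_mult_trans x1(2))
  moreover have "t \<le> infty_mult v'"
    by (meson le_infty_mult order_trans v(2))
  ultimately have "u \<lless> infty_mult v'"
    using st(3) add_le_infty_mult way_below_le_trans by blast
  then show ?case
    using v(3,4) way_below_trans by blast
qed

lemma way_below_infty_mult_shrink:
  fixes u x :: 'a
  assumes "u \<lless> infty_mult x"
  obtains x' where "x' \<lless> x" "u \<lless> infty_mult x'"
  using way_below_infty_multE[OF assms] way_below_multiple_shrink by metis

section \<open>Common lower bounds from (O6) and (O7)\<close>

lemma O6_multiple:
  fixes u' u y :: 'a
  assumes O6: "O6 TYPE('a)" and "u' \<lless> u" "u \<le> (\<Sum>i<(n::nat). y)"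
  shows "\<exists>t. (\<forall>i<n. t i \<lless> u \<and> t i \<lless> y) \<and> u' \<lless> (\<Sum>i<n. t i)"
  using assms(2,3)
proof (induction n arbitrary: u' u)
  case 0
  then show ?case
    using way_below_le_trans by auto
next
  case (Suc n)
  then have "u \<le> (\<Sum>i<n. y) + y"
    by simp
  then obtain v w where vw: "v \<lless> u" "v \<lless> (\<Sum>i<n. y)" "w \<lless> u" "w \<lless> y" "u' \<lless> v + w"
    using O6 Suc.prems(1) unfolding O6_def by blast
  \<comment> \<open>The induction hypothesis needs a strict pair below \<open>v\<close>, so the
    approximation \<open>u' \<lless> v + w\<close> is split once more.\<close>
  obtain v' w' where v': "v' \<lless> v" "w' \<lless> w" "u' \<lless> v' + w'"
    using way_below_addE[OF vw(5)] .
  obtain t where t: "\<And>i. i < n \<Longrightarrow> t i \<lless> v \<and> t i \<lless> y" "v' \<lless> (\<Sum>i<n. t i)"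
    using Suc.IH[OF v'(1) way_below_imp_le[OF vw(2)]] by blast
  let ?t = "t(n := w)"
  have "\<forall>i<Suc n. ?t i \<lless> u \<and> ?t i \<lless> y"
    using t(1) vw way_below_trans by (auto simp: less_Suc_eq)
  moreover have "v' + w' \<le> (\<Sum>i<Suc n. ?t i)"
    using add_mono[OF way_below_imp_le[OF t(2)] way_below_imp_le[OF v'(2)]] by simp
  ultimately show ?case
    using v'(3) way_below_le_trans by blast
qed

text \<open>The sum of the \<open>t i\<close> need not lie below \<open>w\<close>. Adding the
  summands one at a time by (O7) keeps the element below \<open>w\<close> and below the sum, at the
  price of recovering \<open>u\<close> only from its multiples.\<close>

lemma O7_sum:
  fixes u w :: 'a
  assumes O7: "O7 TYPE('a)" and "u \<lless> (\<Sum>i<(n::nat). t i)" "\<And>i. i < n \<Longrightarrow> t i \<lless> w"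
  shows "\<exists>z. z \<lless> w \<and> z \<le> (\<Sum>i<n. t i) \<and> u \<lless> infty_mult z"
  using assms(2,3)
proof (induction n arbitrary: u)
  case 0
  then have "u \<lless> infty_mult 0"
    using le_infty_mult way_below_le_trans by auto
  then show ?case
    using zero_way_below[of w] by auto
next
  case (Suc n)
  then have "u \<lless> (\<Sum>i<n. t i) + t n"
    by simp
  then obtain s' t' where st: "s' \<lless> (\<Sum>i<n. t i)" "t' \<lless> t n" "u \<lless> s' + t'"
    by (rule way_below_addE)
  obtain y where y: "y \<lless> w" "y \<le> (\<Sum>i<n. t i)" "s' \<lless> infty_mult y"
    using Suc.IH[OF st(1)] Suc.prems(2) by auto
  \<comment> \<open>(O7) preserves only elements way below its inputs, so a smaller generator of
    \<open>s'\<close> is passed to it.\<close>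
  obtain y' where y': "y' \<lless> y" "s' \<lless> infty_mult y'"
    using way_below_infty_mult_shrink[OF y(3)] .
  obtain z where z: "y' \<lless> z" "t' \<lless> z" "z \<lless> w" "z \<lless> y + t n"
    using O7 y'(1) y(1) st(2) Suc.prems(2)[of n] unfolding O7_def by blast
  have "s' \<le> infty_mult z"
    by (meson le_infty_mult order_trans way_below_imp_le way_below_infty_mult_trans y'(2) z(1))
  moreover have "t' \<le> infty_mult z"
    by (meson le_infty_mult order_trans way_below_imp_le z(2))
  ultimately have "u \<lless> infty_mult z"
    using st(3) add_le_infty_mult way_below_le_trans by blast
  moreover have "z \<le> (\<Sum>i<Suc n. t i)"
    using way_below_imp_le[OF z(4)] add_right_mono[OF y(2), of "t n"] by simp
  ultimately show ?case
    using z(3) by blast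
qed

text \<open>(O6) cuts \<open>u\<close> into pieces below \<open>y\<close>, and (O7) glues them
  together below \<open>y\<close>. The bound by \<open>n\<close> copies of \<open>u\<close> is what
  later controls \<open>z\<close> from the side of \<open>u\<close>.\<close>

lemma ex_common_below_multiple:
  fixes u' u y :: 'a
  assumes "O6 TYPE('a)" "O7 TYPE('a)" "u' \<lless> u" "u \<le> (\<Sum>i<(n::nat). y)"
  obtains z where "z \<lless> y" "z \<le> (\<Sum>i<n. u)" "u' \<lless> infty_mult z"
proof -
  obtain t where t: "\<And>i. i < n \<Longrightarrow> t i \<lless> u \<and> t i \<lless> y" "u' \<lless> (\<Sum>i<n. t i)"
    using O6_multiple[OF assms(1,3,4)] by blast
  have "(\<Sum>i<n. t i) \<le> (\<Sum>i<n. u)"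
    using t(1) by (intro sum_mono) (simp add: way_below_imp_le)
  then show ?thesis
    using O7_sum[OF assms(2) t(2)] t(1) that order_trans by meson
qed

section \<open>Consequences of divisibility\<close>

lemma divisible_multiple:
  fixes x' x :: 'a
  assumes D: "two_omega_divisible TYPE('a)" and "x' \<lless> x"
  shows "\<exists>z. (\<Sum>i<(n::nat). z) + z \<lless> x \<and> x' \<lless> infty_mult z"
  using assms(2)
proof (induction n arbitrary: x' x)
  case 0
  then obtain z where "z + z \<lless> x" "x' \<lless> infty_mult z"
    using D unfolding two_omega_divisible_def by blast
  moreover from this have "z \<lless> x"
    using le_add_left le_way_below_trans by blast
  ultimately show ?case
    by auto
next
  case (Suc n)
  then obtain z where z: "z + z \<lless> x" "x' \<lless> infty_mult z"
    using D unfolding two_omega_divisible_def by blast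
  obtain z' where z': "z' \<lless> z" "x' \<lless> infty_mult z'"
    using way_below_infty_mult_shrink[OF z(2)] .
  \<comment> \<open>One half \<open>z\<close> holds \<open>n + 1\<close> copies of \<open>w\<close>;
    the other half has room for at least one more.\<close>
  obtain w where w: "(\<Sum>i<n. w) + w \<lless> z" "z' \<lless> infty_mult w"
    using Suc.IH[OF z'(1)] by blast
  have "w \<le> z"
    using le_add_right way_below_imp_le[OF w(1)] order_trans by blast
  then have "(\<Sum>i<Suc n. w) + w \<le> z + z"
    using add_mono[OF way_below_imp_le[OF w(1)]] by simp
  moreover have "x' \<lless> infty_mult w"
    using way_below_infty_mult_trans[OF z'(2)] way_below_imp_le[OF w(2)] by blast
  ultimately show ?case
    using z(1) le_way_below_trans by blast
qed

lemma divisible_imp_weakly_divisible: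
  assumes D: "two_omega_divisible TYPE('a)"
  shows "weakly_two_omega_divisible TYPE('a)"
  unfolding weakly_two_omega_divisible_def
proof (intro allI impI)
  fix x' x :: 'a
  assume "x' \<lless> x"
  then obtain z where z: "z + z \<lless> x" "x' \<lless> infty_mult z"
    using D unfolding two_omega_divisible_def by blast
  obtain n :: nat where "x' \<lless> (\<Sum>i<n. z)"
    using way_below_infty_multE[OF z(2)] .
  moreover have "(\<Sum>i<n. z) = (\<Sum>j=1..n. z)"
    by (rule sum.reindex_bij_witness[of _ "\<lambda>i. i - 1" Suc]) auto
  ultimately show "\<exists>(n::nat) z. (\<forall>j\<in>{1..n}. z j + z j \<lless> x) \<and> x' \<lless> (\<Sum>j=1..n. z j)"
    using z(1) by (intro exI[of _ n] exI[of _ "\<lambda>_. z"]) simp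
qed

lemma divisible_imp_ideal_filtered:
  assumes "O6 TYPE('a)" "O7 TYPE('a)" "two_omega_divisible TYPE('a)"
  shows "ideal_filtered TYPE('a)"
  unfolding ideal_filtered_def
proof (intro allI impI)
  fix v' v x y :: 'a
  assume v: "v' \<lless> v" "v \<lless> infty_mult x" "v \<lless> infty_mult y"
  obtain m :: nat where m: "v \<lless> (\<Sum>i<m. x)"
    using way_below_infty_multE[OF v(2)] .
  obtain x1 where x1: "x1 \<lless> x" "x1 \<le> (\<Sum>i<m. v)" "v' \<lless> infty_mult x1"
    using ex_common_below_multiple[OF assms(1,2) v(1) way_below_imp_le[OF m]] .
  \<comment> \<open>Although \<open>x1\<close> was chosen below \<open>x\<close>, its bound by a
    multiple of \<open>v\<close> keeps it in the ideal of \<open>y\<close>.\<close>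
  have x1y: "x1 \<le> infty_mult y"
    using x1(2) multiple_le_infty_multI[OF way_below_imp_le[OF v(3)]] order_trans by blast
  obtain x2 where x2: "x2 \<lless> x1" "v' \<lless> infty_mult x2"
    using way_below_infty_mult_shrink[OF x1(3)] .
  obtain n :: nat where n: "x2 \<lless> (\<Sum>i<n. y)"
    using way_below_infty_multE[OF way_below_le_trans[OF x2(1) x1y]] .
  obtain x3 where x3: "x3 \<lless> x2" "v' \<lless> infty_mult x3"
    using way_below_infty_mult_shrink[OF x2(2)] .
  \<comment> \<open>The number \<open>n\<close> is fixed before dividing, so that \<open>n\<close> pieces below \<open>x4\<close> add up to less than \<open>x2\<close>.\<close>
  obtain x4 where x4: "(\<Sum>i<n. x4) + x4 \<lless> x2" "x3 \<lless> infty_mult x4"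
    using divisible_multiple[OF assms(3) x3(1)] by blast
  have "v' \<lless> infty_mult x4"
    using way_below_infty_mult_trans[OF x3(2)] way_below_imp_le[OF x4(2)] by blast
  then obtain x5 where x5: "x5 \<lless> x4" "v' \<lless> infty_mult x5"
    by (rule way_below_infty_mult_shrink)
  \<comment> \<open>Since \<open>x4 \<le> x2\<close>, the same \<open>n\<close> works for
    \<open>x4\<close>, and the resulting \<open>z\<close> is bounded by \<open>n\<close> copies of
    \<open>x4\<close>.\<close>
  have "x4 \<le> (\<Sum>i<n. y)"
    using le_add_right way_below_imp_le[OF x4(1)] way_below_imp_le[OF n] order_trans by meson
  then obtain z where z: "z \<lless> y" "z \<le> (\<Sum>i<n. x4)" "x5 \<lless> infty_mult z"
    using ex_common_below_multiple[OF assms(1,2) x5(1)] by blast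
  have "z \<le> (\<Sum>i<n. x4) + x4"
    using z(2) le_add_left order_trans by blast
  then have "z \<lless> x"
    using x4(1) x2(1) x1(1) le_way_below_trans way_below_trans by blast
  moreover have "v' \<lless> infty_mult z"
    using way_below_infty_mult_trans[OF x5(2)] way_below_imp_le[OF z(3)] by blast
  ultimately show "\<exists>z. v' \<lless> infty_mult z \<and> z \<lless> x \<and> z \<lless> y"
    using z(1) by blast
qed

text \<open>A half of \<open>x\<close> that generates \<open>c\<close> also generates
  \<open>d1'\<close> and \<open>d2'\<close>, so it can serve as both summands.\<close>

lemma divisible_imp_property_V:
  assumes D: "two_omega_divisible TYPE('a)"
  shows "property_V TYPE('a)"
  unfolding property_V_def
proof (intro allI impI)
  fix c d1' d1 d2' d2 x :: 'a
  assume d: "d1' \<lless> d1" "d2' \<lless> d2" "d1 \<lless> c" "d2 \<lless> c" and "c + d1 \<lless> x"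
  then have "c \<lless> x"
    using le_add_left le_way_below_trans by blast
  then obtain z where z: "z + z \<lless> x" "c \<lless> infty_mult z"
    using D unfolding two_omega_divisible_def by blast
  have "d1' \<le> infty_mult z" "d2' \<le> infty_mult z"
    using d z(2) way_below_trans way_below_imp_le by meson+
  then show "\<exists>y z. y + z \<le> x \<and> d1' + d2' \<le> infty_mult y \<and> d1' + d2' \<le> infty_mult z"
    using z(1) add_le_infty_mult way_below_imp_le by blast
qed

section \<open>Merging halves by (O5), filteredness and (V)\<close>

lemma ex_full_complement:
  fixes a' a x :: 'a
  assumes O5: "O5 TYPE('a)" and "a' \<lless> a" "a + a \<le> x"
  obtains r where "a' + r \<le> x" "x \<le> infty_mult r"
proof -
  obtain a1 where a1: "a' \<lless> a1" "a1 \<lless> a"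
    using way_below_interpolate[OF assms(2)] .
  have "a1 + a \<le> x"
    using add_right_mono[OF way_below_imp_le[OF a1(2)]] assms(3) order_trans by blast
  \<comment> \<open>(O5) is applied to \<open>a' \<lless> a1\<close> and
    \<open>a1 \<lless> a\<close>. The complement \<open>r\<close> then dominates \<open>a1\<close>,
    whence \<open>x \<le> a1 + r \<le> r + r\<close>.\<close>
  then obtain r where r: "a1 \<lless> r" "a' + r \<le> x" "x \<le> a1 + r"
    using O5 a1 unfolding O5_def by blast
  have "a1 + r \<le> infty_mult r"
    by (meson add_le_infty_mult le_infty_mult order_trans r(1) way_below_imp_le)
  then show ?thesis
    using that r(2,3) order_trans by blast
qed

lemma merge_halves:
  fixes a' a b' b x :: 'a
  assumes O5: "O5 TYPE('a)" and F: "ideal_filtered TYPE('a)" and V: "property_V TYPE('a)"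
    and a: "a' \<lless> a" "a + a \<lless> x" and b: "b' \<lless> b" "b + b \<lless> x"
  obtains e where "e + e \<lless> x" "a' \<lless> infty_mult e" "b' \<lless> infty_mult e"
proof -
  obtain a1 where a1: "a' \<lless> a1" "a1 \<lless> a"
    using way_below_interpolate[OF a(1)] .
  obtain b1 where b1: "b' \<lless> b1" "b1 \<lless> b"
    using way_below_interpolate[OF b(1)] .
  obtain ra where ra: "a1 + ra \<le> x" "x \<le> infty_mult ra"
    using ex_full_complement[OF O5 a1(2) way_below_imp_le[OF a(2)]] .
  obtain rb where rb: "b1 + rb \<le> x" "x \<le> infty_mult rb"
    using ex_full_complement[OF O5 b1(2) way_below_imp_le[OF b(2)]] .
  have "a \<lless> x" "b \<lless> x"
    using a(2) b(2) le_add_left le_way_below_trans by blast+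
  then obtain v' v where v: "a \<le> v'" "b \<le> v'" "v' \<lless> v" "v \<lless> x"
    by (rule way_below_directed)
  \<comment> \<open>Both complements generate ideals containing \<open>x\<close>, so filteredness
    applies to \<open>v' \<lless> v\<close> and gives a common \<open>s\<close> that generates
    \<open>a\<close> and \<open>b\<close>.\<close>
  then obtain s where s: "v' \<lless> infty_mult s" "s \<lless> ra" "s \<lless> rb"
    using F ra(2) rb(2) way_below_le_trans unfolding ideal_filtered_def by meson
  \<comment> \<open>Filteredness for \<open>u1\<close> and \<open>s\<close> finds a part of
    \<open>u1\<close> below \<open>s\<close> that generates \<open>u\<close>; shrinking it gives the
    strict pair required by (V).\<close>
  have part: "\<exists>d' d. d' \<lless> d \<and> u \<lless> infty_mult d' \<and> d \<lless> s \<and> d \<lless> u1"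
    if u: "u \<lless> u1" "u1 \<le> v'" for u u1
  proof -
    obtain u2 where u2: "u \<lless> u2" "u2 \<lless> u1"
      using way_below_interpolate[OF u(1)] .
    have "u2 \<lless> infty_mult u1" "u2 \<lless> infty_mult s"
      using u2(2) le_infty_mult u(2) s(1) way_below_le_trans way_below_imp_le by meson+
    then obtain d where d: "u \<lless> infty_mult d" "d \<lless> s" "d \<lless> u1"
      using F u2(1) unfolding ideal_filtered_def by meson
    then show ?thesis
      using way_below_infty_mult_shrink[OF d(1)] by metis
  qed
  obtain c' c where c: "c' \<lless> c" "a' \<lless> infty_mult c'" "c \<lless> s" "c \<lless> a1"
    using part[OF a1(1)] v(1) a1(2) way_below_imp_le order_trans by meson
  obtain d' d where d: "d' \<lless> d" "b' \<lless> infty_mult d'" "d \<lless> s" "d \<lless> b1"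
    using part[OF b1(1)] v(2) b1(2) way_below_imp_le order_trans by meson
  \<comment> \<open>In (V), \<open>s\<close> is the large summand and \<open>c\<close>,
    \<open>d\<close> are the small ones. The bounds come from \<open>s + c \<lless> ra + a1\<close>
    and \<open>s + d \<lless> rb + b1\<close>.\<close>
  have "s + c \<lless> x" "s + d \<lless> x"
    using way_below_add[OF s(2) c(4)] way_below_add[OF s(3) d(4)] ra(1) rb(1)
    by (simp_all add: add.commute way_below_le_trans)
  then obtain y z where yz: "y + z \<le> x" "c' + d' \<le> infty_mult y" "c' + d' \<le> infty_mult z"
    using V c(1,3) d(1,3) unfolding property_V_def by meson
  have "a' \<lless> infty_mult (c' + d')" "b' \<lless> infty_mult (c' + d')"
    using c(2) d(2) way_below_infty_mult_trans le_infty_mult le_add_left le_add_right order_trans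
    by meson+
  \<comment> \<open>A single \<open>w'\<close> above \<open>a'\<close> and \<open>b'\<close> makes
    one application of filteredness to \<open>y\<close> and \<open>z\<close> suffice; then
    \<open>e + e \<lless> y + z \<le> x\<close>.\<close>
  then obtain w' w where w: "a' \<le> w'" "b' \<le> w'" "w' \<lless> w" "w \<lless> infty_mult (c' + d')"
    by (rule way_below_directed)
  then obtain e where e: "w' \<lless> infty_mult e" "e \<lless> y" "e \<lless> z"
    using F yz(2,3) way_below_infty_mult_trans unfolding ideal_filtered_def by meson
  then show ?thesis
    using that way_below_le_trans[OF way_below_add[OF e(2,3)] yz(1)] w(1,2) le_way_below_trans
    by blast
qed

lemma merge_finitely_many_halves:
  fixes u x :: 'a
  assumes O5: "O5 TYPE('a)" and F: "ideal_filtered TYPE('a)" and V: "property_V TYPE('a)"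
    and "u \<lless> (\<Sum>j=1..n. z j)" "\<forall>j\<in>{1..(n::nat)}. z j + z j \<lless> x"
  shows "\<exists>e. e + e \<lless> x \<and> u \<lless> infty_mult e"
  using assms(4,5)
proof (induction n arbitrary: u)
  case 0
  then have "u \<lless> infty_mult 0"
    using le_infty_mult way_below_le_trans by auto
  then show ?case
    using zero_way_below[of x] by (intro exI[of _ 0]) simp
next
  case (Suc n)
  then have "u \<lless> (\<Sum>j=1..n. z j) + z (Suc n)"
    by simp
  then obtain s t where st: "s \<lless> (\<Sum>j=1..n. z j)" "t \<lless> z (Suc n)" "u \<lless> s + t"
    by (rule way_below_addE)
  obtain e where e: "e + e \<lless> x" "s \<lless> infty_mult e"
    using Suc.IH[OF st(1)] Suc.prems(2) by auto
  \<comment> \<open>Merging recovers only elements way below \<open>e\<close>, so a smaller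
    generator of \<open>s\<close> is chosen first.\<close>
  obtain e' where e': "e' \<lless> e" "s \<lless> infty_mult e'"
    using way_below_infty_mult_shrink[OF e(2)] .
  obtain f where f: "f + f \<lless> x" "e' \<lless> infty_mult f" "t \<lless> infty_mult f"
    using merge_halves[OF O5 F V e'(1) e(1) st(2)] Suc.prems(2) by auto
  have "s \<le> infty_mult f"
    using way_below_infty_mult_trans[OF e'(2)] f(2) way_below_imp_le by blast
  then have "s + t \<le> infty_mult f"
    using f(3) add_le_infty_mult way_below_imp_le by blast
  then show ?case
    using f(1) st(3) way_below_le_trans by blast
qed

end

theorem theorem1:
  assumes "Cu_semigroup TYPE('a::pos_ordered_monoid)"
    and "O5 TYPE('a)" and "O6 TYPE('a)" and "O7 TYPE('a)" and "O8 TYPE('a)"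
  shows "two_omega_divisible TYPE('a) \<longleftrightarrow>
    weakly_two_omega_divisible TYPE('a) \<and> ideal_filtered TYPE('a) \<and> property_V TYPE('a)"
proof (intro iffI conjI)
  assume D: "two_omega_divisible TYPE('a)"
  show "weakly_two_omega_divisible TYPE('a)"
    by (rule divisible_imp_weakly_divisible[OF assms(1) D])
  show "ideal_filtered TYPE('a)"
    by (rule divisible_imp_ideal_filtered[OF assms(1,3,4) D])
  show "property_V TYPE('a)"
    by (rule divisible_imp_property_V[OF assms(1) D])
next
  assume W: "weakly_two_omega_divisible TYPE('a) \<and> ideal_filtered TYPE('a) \<and> property_V TYPE('a)"
  show "two_omega_divisible TYPE('a)"
    unfolding two_omega_divisible_def
  proof (intro allI impI)
    fix x' x :: 'a
    assume "x' \<lless> x"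
    then obtain n :: nat and z where "\<forall>j\<in>{1..n}. z j + z j \<lless> x" "x' \<lless> (\<Sum>j=1..n. z j)"
      using W unfolding weakly_two_omega_divisible_def by meson
    then show "\<exists>z. z + z \<lless> x \<and> x' \<lless> infty_mult z"
      using merge_finitely_many_halves[OF assms(1,2)] W by blast
  qed
qed

end
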